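(* Let $n\ge 3$, let $M\ge 1$ and $\bar M=\log M$, let $A\in{\cal P}_n\cap[1/M,M]^{n\times n}$, and put $\bar a_{ij}=\log a_{ij}$. Let $\alpha_n\ge 0$ denote the acceptance threshold of inconsistency and let $\alpha_n^*=(\alpha_n+2)\binom{n}{3}$. Consider the mixed 0-1 optimization problem in the real variables $x_{ij}$ ($1\le i,j\le n$, $i\neq j$) and the binary variables $y_{ij}$ ($1\le i<j\le n$): $$\begin{array}{rll} \min & \sum_{i=1}^{n-1}\sum_{j=i+1}^{n} y_{ij} & \\ \mathrm{s.t.} & \sum_{i=1}^{n-2}\sum_{j=i+1}^{n-1}\sum_{k=j+1}^{n}\left(e^{x_{ik}-x_{ij}-x_{jk}}+e^{x_{ij}+x_{jk}-x_{ik}}\right)\le \alpha_n^*, & \\ & x_{ij}=-x_{ji}, & 1\le i<j\le n,\\ & -\bar M\le x_{ij}\le \bar M, & 1\le i<j\le n,\\ & -2\bar M y_{ij}\le x_{ij}-\bar a_{ij}\le 2\bar M y_{ij}, & 1\le i<j\le n,\\ & y_{ij}\in\{0,1\}, & 1\le i<j\le n. \end{array}$$ Then the optimum value of this problem equals the minimal number of elements above the main diagonal of $A$ that have to be modified (together with their reciprocals) in order to achieve $CI_n\le\alpha_n$, i.e. it equals $$\min\{\,d(A,\hat A)\ :\ \hat A\in{\cal P}_n\cap[1/M,M]^{n\times n},\ CI_n(\hat A)\le\alpha_n\,\}.$$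
   Context: ${\cal P}_n$ is the set of $n\times n$ pairwise comparison matrices: real matrices $A=(a_{ij})$ with $a_{ij}>0$ and $a_{ij}=1/a_{ji}$ for all $i,j$ (so $a_{ii}=1$). $[1/M,M]^{n\times n}$ is the set of $n\times n$ matrices all of whose entries lie in $[1/M,M]$. For $A,\hat A\in{\cal P}_n$, $d(A,\hat A)=|\{(i,j):1\le i<j\le n,\ a_{ij}\ne\hat a_{ij}\}|$. The triads of $A\in{\cal P}_n$ are its $NT(n)=\binom n3$ principal $3\times3$ submatrices $\Gamma_1,\dots,\Gamma_{NT(n)}$ (one for each $1\le i<j<k\le n$, formed by rows and columns $i,j,k$). The inconsistency index of Pel\'aez and Lamata is $CI_n(A)=\det(A)$ for $n=3$ and $CI_n(A)=\frac{1}{NT(n)}\sum_{i=1}^{NT(n)}\det(\Gamma_i)$ for $n>3$. *)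

theory Defs
  imports
    Complex_Main
    "Jordan_Normal_Form.Determinant"
    "Jordan_Normal_Form.DL_Submatrix"
begin

(* Rows and columns are numbered from 0, as in the matrix library: the indices
   1 <= i < j <= n of the mathematics are i < j < n here. *)

definition pc_matrices :: "nat \<Rightarrow> real mat set" where
  "pc_matrices n = {A \<in> carrier_mat n n.
     \<forall>i<n. \<forall>j<n. A $$ (i, j) > 0 \<and> A $$ (i, j) = 1 / A $$ (j, i)}"

definition bounded_matrices :: "nat \<Rightarrow> real \<Rightarrow> real mat set" where
  "bounded_matrices n M = {A \<in> carrier_mat n n.
     \<forall>i<n. \<forall>j<n. 1 / M \<le> A $$ (i, j) \<and> A $$ (i, j) \<le> M}"

definition pc_dist :: "nat \<Rightarrow> real mat \<Rightarrow> real mat \<Rightarrow> nat" where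
  "pc_dist n A B = card {(i, j). i < j \<and> j < n \<and> A $$ (i, j) \<noteq> B $$ (i, j)}"

definition triad :: "real mat \<Rightarrow> nat \<times> nat \<times> nat \<Rightarrow> real mat" where
  "triad A = (\<lambda>(i, j, k). submatrix A {i, j, k} {i, j, k})"

definition triad_indices :: "nat \<Rightarrow> (nat \<times> nat \<times> nat) set" where
  "triad_indices n = {(i, j, k). i < j \<and> j < k \<and> k < n}"

(* The inconsistency index of Pelaez and Lamata, meaningful for n >= 3. *)
definition CI :: "nat \<Rightarrow> real mat \<Rightarrow> real" where
  "CI n A = (if n = 3 then det A
     else (1 / real (n choose 3)) * (\<Sum>t\<in>triad_indices n. det (triad A t)))"

definition alpha_star :: "nat \<Rightarrow> real \<Rightarrow> real" where
  "alpha_star n \<alpha> = (\<alpha> + 2) * real (n choose 3)"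

(* Only the values x i j with i, j < n, i ~= j, and y i j with i < j < n are
   variables of the problem; all other values are unconstrained and do not
   enter the objective. *)
definition feasible ::
    "nat \<Rightarrow> real \<Rightarrow> real mat \<Rightarrow> real \<Rightarrow> (nat \<Rightarrow> nat \<Rightarrow> real) \<Rightarrow> (nat \<Rightarrow> nat \<Rightarrow> real) \<Rightarrow> bool" where
  "feasible n M A \<alpha> x y \<longleftrightarrow>
     (\<Sum>i\<in>{0..<n-2}. \<Sum>j\<in>{i+1..<n-1}. \<Sum>k\<in>{j+1..<n}.
        exp (x i k - x i j - x j k) + exp (x i j + x j k - x i k)) \<le> alpha_star n \<alpha> \<and>
     (\<forall>i j. i < j \<and> j < n \<longrightarrow>
        x i j = - x j i \<and>
        - ln M \<le> x i j \<and> x i j \<le> ln M \<and>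
        - 2 * ln M * y i j \<le> x i j - ln (A $$ (i, j)) \<and>
        x i j - ln (A $$ (i, j)) \<le> 2 * ln M * y i j \<and>
        y i j \<in> {0, 1})"

definition objective :: "nat \<Rightarrow> (nat \<Rightarrow> nat \<Rightarrow> real) \<Rightarrow> real" where
  "objective n y = (\<Sum>i\<in>{0..<n-1}. \<Sum>j\<in>{i+1..<n}. y i j)"

(* v is the minimum, in particular attained, of f on X. *)
definition is_min_value :: "('a \<Rightarrow> 'b::linorder) \<Rightarrow> 'a set \<Rightarrow> 'b \<Rightarrow> bool" where
  "is_min_value f X v \<longleftrightarrow> v \<in> f ` X \<and> (\<forall>x\<in>X. v \<le> f x)"

end

theory Submission
  imports Defs
begin

text \<open>
  The optimization problem is the original modification problem in logarithmic coordinates.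
  For a triad with entries \<open>a = a\<^sub>i\<^sub>j\<close>, \<open>b = a\<^sub>i\<^sub>k\<close>, \<open>c = a\<^sub>j\<^sub>k\<close> above the diagonal, the determinant
  is \<open>b / (a c) + a c / b - 2\<close>. With \<open>x\<^sub>i\<^sub>j = ln a\<^sub>i\<^sub>j\<close> the two quotients become the two exponentials
  in the constraint, and summation over the \<open>n choose 3\<close> triads turns the threshold \<open>\<alpha>\<close> on the mean
  of the determinants into the bound \<open>(\<alpha> + 2) (n choose 3)\<close>: this is \<open>CI_le_iff_exp_sum_le\<close>.

  The binary variables count modifications. If \<open>y\<^sub>i\<^sub>j = 0\<close>, the entry \<open>(i, j)\<close> is forced to keep its value;
  if \<open>y\<^sub>i\<^sub>j = 1\<close>, the constraint on \<open>x\<^sub>i\<^sub>j - ln a\<^sub>i\<^sub>j\<close> is void, since both logarithms lie in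
  \<open>[-ln M, ln M]\<close>. The logarithms of an acceptable matrix \<open>B\<close>, with the indicator of the modified
  positions, are thus feasible with value exactly \<open>d(A, B)\<close> (\<open>pc_matrix_yields_feasible\<close>).
  Conversely, exponentiating a feasible point gives an acceptable matrix, whose distance
  from \<open>A\<close> is at most the objective: some \<open>y\<^sub>i\<^sub>j\<close> may be 1 without need, so in this direction there is
  only an inequality (\<open>feasible_yields_pc_matrix\<close>). Together these show that the two
  minimum values agree. A minimum exists because distances are natural numbers and the matrix
  of ones, which is consistent, is acceptable for every \<open>\<alpha> \<ge> 0\<close>.
\<close>

section \<open>Determinants of triads\<close>

lemma det_2_entries:
  fixes A :: "'a::comm_ring_1 mat"
  assumes A: "A \<in> carrier_mat 2 2"
  shows "det A = A $$ (0,0) * A $$ (1,1) - A $$ (0,1) * A $$ (1,0)"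
proof -
  have d: "det (mat_delete A i 0) = mat_delete A i 0 $$ (0,0)" for i
    using A by (intro det_single) (auto simp: mat_delete_def)
  show ?thesis
    using A by (subst laplace_expansion_column[OF A, of 0])
      (simp_all add: numeral_2_eq_2 cofactor_def d, simp_all add: mat_delete_def)
qed

lemma det_3_entries:
  fixes A :: "'a::comm_ring_1 mat"
  assumes A: "A \<in> carrier_mat 3 3"
  shows "det A =
      A $$ (0,0) * (A $$ (1,1) * A $$ (2,2) - A $$ (1,2) * A $$ (2,1))
    - A $$ (1,0) * (A $$ (0,1) * A $$ (2,2) - A $$ (0,2) * A $$ (2,1))
    + A $$ (2,0) * (A $$ (0,1) * A $$ (1,2) - A $$ (0,2) * A $$ (1,1))"
proof -
  have d: "det (mat_delete A i 0) = mat_delete A i 0 $$ (0,0) * mat_delete A i 0 $$ (1,1)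
      - mat_delete A i 0 $$ (0,1) * mat_delete A i 0 $$ (1,0)" for i
    using A by (intro det_2_entries) (auto simp: mat_delete_def)
  show ?thesis
    using A by (subst laplace_expansion_column[OF A, of 0])
      (simp_all add: eval_nat_numeral cofactor_def d, simp_all add: mat_delete_def eval_nat_numeral algebra_simps)
qed

lemma pick_sorted_triple:
  assumes "i < j" "j < k"
  shows "pick {i,j,k} 0 = i" "pick {i,j,k} 1 = j" "pick {i,j,k} 2 = k"
proof -
  show 0: "pick {i,j,k} 0 = i"
    using assms by (auto intro!: Least_equality)
  show 1: "pick {i,j,k} 1 = j"
    using assms 0 by (auto intro!: Least_equality)
  show "pick {i,j,k} 2 = k"
    using assms 1 by (auto simp: numeral_2_eq_2 simp del: pick.simps(1) intro!: Least_equality)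
qed

text \<open>Turns the index sets of a principal submatrix, in which position \<open>r\<close> stands
  for the \<open>r\<close>-th smallest index, into explicit positions.\<close>

lemma submatrix_sorted_triple:
  assumes A: "A \<in> carrier_mat n n" and ijk: "i < j" "j < k" "k < n"
  shows "submatrix A {i,j,k} {i,j,k} = mat 3 3 (\<lambda>(r,c). A $$ ([i,j,k] ! r, [i,j,k] ! c))"
proof -
  have set_eq: "{a. a < n \<and> a \<in> {i,j,k}} = {i,j,k}"
    using ijk by auto
  have "card {i,j,k} = 3" using ijk by simp
  moreover have "pick {i,j,k} r = [i,j,k] ! r" if "r < 3" for r
  proof -
    have "r = 0 \<or> r = 1 \<or> r = 2" using that by auto
    then show ?thesis using pick_sorted_triple[OF ijk(1,2)] by auto
  qed
  ultimately show ?thesis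
    using A set_eq by (intro eq_matI) (auto simp: submatrix_def)
qed

text \<open>The reciprocity law rewrites an entry to a term containing its mirror image, and hence loops
  as a simplification rule; separate facts allow it to be used at chosen indices.\<close>

lemma pc_matricesD:
  assumes "B \<in> pc_matrices n"
  shows "B \<in> carrier_mat n n"
    and "\<And>i j. i < n \<Longrightarrow> j < n \<Longrightarrow> B $$ (i,j) > 0"
    and "\<And>i j. i < n \<Longrightarrow> j < n \<Longrightarrow> B $$ (i,j) = 1 / B $$ (j,i)"
  using assms unfolding pc_matrices_def by blast+

lemma pc_matrices_diag:
  assumes B: "B \<in> pc_matrices n" and i: "i < n"
  shows "B $$ (i,i) = 1"
proof -
  have pos: "B $$ (i,i) > 0" using pc_matricesD(2)[OF B i i] .
  have "B $$ (i,i) * B $$ (i,i) = 1"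
    using pos by (subst (2) pc_matricesD(3)[OF B i i]) simp
  then show ?thesis
    using pos by (simp add: square_eq_1_iff)
qed

text \<open>A triad \<open>i, j, k\<close> is consistent when \<open>B\<^sub>i\<^sub>j B\<^sub>j\<^sub>k = B\<^sub>i\<^sub>k\<close>. Its determinant is \<open>q + 1/q - 2\<close> for the
  quotient \<open>q\<close> of the two sides: of the six terms of the Leibniz formula, the identity and the three
  transpositions contribute \<open>1 - 3\<close> by reciprocity, and the two 3-cycles contribute \<open>q\<close> and \<open>1/q\<close>.\<close>

lemma det_triad:
  assumes B: "B \<in> pc_matrices n" and ijk: "i < j" "j < k" "k < n"
  shows "det (triad B (i,j,k)) =
    B $$ (i,k) / (B $$ (i,j) * B $$ (j,k)) + B $$ (i,j) * B $$ (j,k) / B $$ (i,k) - 2"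
proof -
  note carrier = pc_matricesD(1)[OF B]
  have lower: "B $$ (j,i) = 1 / B $$ (i,j)" "B $$ (k,i) = 1 / B $$ (i,k)" "B $$ (k,j) = 1 / B $$ (j,k)"
    using ijk by (intro pc_matricesD(3)[OF B]; simp)+
  have p: "B $$ (i,j) > 0" "B $$ (i,k) > 0" "B $$ (j,k) > 0"
    using ijk by (intro pc_matricesD(2)[OF B]; simp)+
  have "det (triad B (i,j,k)) =
      B $$ (i,i) * (B $$ (j,j) * B $$ (k,k) - B $$ (j,k) * B $$ (k,j))
    - B $$ (j,i) * (B $$ (i,j) * B $$ (k,k) - B $$ (i,k) * B $$ (k,j))
    + B $$ (k,i) * (B $$ (i,j) * B $$ (j,k) - B $$ (i,k) * B $$ (j,j))"
    unfolding triad_def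
    by (simp add: submatrix_sorted_triple[OF carrier ijk] det_3_entries)
  moreover have "B $$ (i,i) = 1" "B $$ (j,j) = 1" "B $$ (k,k) = 1"
    using ijk by (intro pc_matrices_diag[OF B]; simp)+
  ultimately show ?thesis
    using p by (simp add: lower field_simps)
qed

section \<open>The inconsistency index in logarithmic coordinates\<close>

lemma triad_indices_Sigma:
  "triad_indices n = (SIGMA i:{0..<n-2}. SIGMA j:{i+1..<n-1}. {j+1..<n})"
  by (auto simp: triad_indices_def)

lemma sum_triad_indices:
  "(\<Sum>t\<in>triad_indices n. f t) =
    (\<Sum>i\<in>{0..<n-2}. \<Sum>j\<in>{i+1..<n-1}. \<Sum>k\<in>{j+1..<n}. f (i,j,k))"
  unfolding triad_indices_Sigma by (simp add: sum.Sigma split_def)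

text \<open>Triples \<open>i < j < k\<close> correspond to three-element sets; sorting the set recovers the triple.\<close>

lemma card_triad_indices: "card (triad_indices n) = n choose 3"
proof -
  let ?f = "\<lambda>(i, j, k). {i, j, k :: nat}"
  have sorted: "sorted_list_of_set {i,j,k} = [i,j,k]" if "i < j" "j < k" for i j k :: nat
    using sorted_list_of_set.idem_if_sorted_distinct[of "[i,j,k]"] that by auto
  have "inj_on ?f (triad_indices n)"
    by (rule inj_on_inverseI[where g = "\<lambda>S. let l = sorted_list_of_set S in (l ! 0, l ! 1, l ! 2)"])
      (auto simp: triad_indices_def sorted simp del: sorted_list_of_set_insert_remove)
  moreover have "?f ` triad_indices n = {S. S \<subseteq> {0..<n} \<and> card S = 3}"
  proof (intro equalityI subsetI)
    fix S assume "S \<in> {S. S \<subseteq> {0..<n} \<and> card S = 3}"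
    then have S: "S \<subseteq> {0..<n}" "card S = 3" "finite S"
      using finite_subset[of S "{0..<n}"] by auto
    have three: "\<exists>i j k. l = [i,j,k]" if "length l = 3" for l :: "nat list"
      using that by (auto simp: numeral_3_eq_3 length_Suc_conv)
    obtain i j k where l: "sorted_list_of_set S = [i,j,k]"
      using three[of "sorted_list_of_set S"] S(2) by auto
    then have "S = {i,j,k}"
      using set_sorted_list_of_set[OF S(3)] by simp
    moreover have "i < j" "j < k"
      using strict_sorted_list_of_set[of S] by (simp_all add: l)
    ultimately show "S \<in> ?f ` triad_indices n"
      using S by (intro image_eqI[of _ _ "(i,j,k)"]) (auto simp: triad_indices_def)
  qed (auto simp: triad_indices_def)
  ultimately show ?thesis
    using card_image[of ?f "triad_indices n"] n_subsets[of "{0..<n}" 3] by simp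
qed

text \<open>For \<open>n = 3\<close> the matrix is its own only triad, so its determinant is already the mean. This removes the
  case distinction in the index.\<close>

lemma CI_eq_mean_det_triad:
  assumes B: "B \<in> pc_matrices n" and n: "n \<ge> 3"
  shows "CI n B = (\<Sum>t\<in>triad_indices n. det (triad B t)) / real (n choose 3)"
proof (cases "n = 3")
  case True
  have "triad_indices 3 = {(0,1,2)}"
    by (auto simp: triad_indices_def)
  moreover have "triad B (0,1,2) = B"
  proof -
    have carrier: "B \<in> carrier_mat 3 3"
      using pc_matricesD(1)[OF B] True by simp
    have "[0,1,2] ! r = r" if "r < 3" for r :: nat
      using that by (auto simp: less_Suc_eq numeral_3_eq_3)
    then show ?thesis
      using carrier unfolding triad_def
      by (simp add: submatrix_sorted_triple[OF carrier]) auto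
  qed
  ultimately show ?thesis
    using True by (simp add: CI_def)
qed (simp add: CI_def)

text \<open>Each triad contributes the sum of two exponentials minus 2. The constants 2 add up to
  \<open>2 (n choose 3)\<close>, which accounts for the shift from \<open>\<alpha>\<close> to \<open>\<alpha> + 2\<close> in the bound. Only the
  entries above the diagonal enter, so \<open>x\<close> is left arbitrary elsewhere.\<close>

lemma CI_le_iff_exp_sum_le:
  assumes B: "B \<in> pc_matrices n" and n: "n \<ge> 3"
    and x: "\<And>i j. i < j \<Longrightarrow> j < n \<Longrightarrow> B $$ (i,j) = exp (x i j)"
  shows "CI n B \<le> \<alpha> \<longleftrightarrow>
     (\<Sum>i\<in>{0..<n-2}. \<Sum>j\<in>{i+1..<n-1}. \<Sum>k\<in>{j+1..<n}.
        exp (x i k - x i j - x j k) + exp (x i j + x j k - x i k)) \<le> alpha_star n \<alpha>"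
proof -
  let ?e = "\<lambda>(i,j,k). exp (x i k - x i j - x j k) + exp (x i j + x j k - x i k)"
  have "det (triad B t) = ?e t - 2" if t: "t \<in> triad_indices n" for t
  proof -
    obtain i j k where "t = (i,j,k)" "i < j" "j < k" "k < n"
      using t by (auto simp: triad_indices_def)
    then show ?thesis
      using x[of i j] x[of i k] x[of j k]
      by (simp add: det_triad[OF B] exp_add exp_diff)
  qed
  then have "(\<Sum>t\<in>triad_indices n. det (triad B t)) = (\<Sum>t\<in>triad_indices n. ?e t - 2)"
    by (intro sum.cong) simp_all
  also have "\<dots> = (\<Sum>t\<in>triad_indices n. ?e t) - 2 * real (n choose 3)"
    by (simp only: sum_subtractf) (simp add: card_triad_indices)
  finally have "CI n B \<le> \<alpha> \<longleftrightarrow>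
      (\<Sum>t\<in>triad_indices n. ?e t) - 2 * real (n choose 3) \<le> \<alpha> * real (n choose 3)"
    using n by (simp add: CI_eq_mean_det_triad[OF B n] pos_divide_le_eq)
  then show ?thesis
    by (simp add: alpha_star_def sum_triad_indices algebra_simps)
qed

section \<open>Matrices and feasible points\<close>

lemma objective_eq_card_support:
  assumes "\<And>i j. i < j \<Longrightarrow> j < n \<Longrightarrow> y i j \<in> {0, 1}"
  shows "objective n y = real (card {(i, j). i < j \<and> j < n \<and> y i j \<noteq> 0})"
proof -
  let ?P = "SIGMA i:{0..<n-1}. {i+1..<n}"
  let ?S = "{(i, j). i < j \<and> j < n \<and> y i j \<noteq> 0}"
  have "objective n y = (\<Sum>(i,j)\<in>?P. y i j)"
    by (simp add: objective_def sum.Sigma split_def)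
  also have "\<dots> = (\<Sum>(i,j)\<in>?S. y i j)"
    by (intro sum.mono_neutral_right) auto
  also have "\<dots> = (\<Sum>p\<in>?S. 1)"
    using assms by (intro sum.cong) auto
  finally show ?thesis by simp
qed

lemma pc_matrix_yields_feasible:
  assumes n: "n \<ge> 3"
    and A: "A \<in> pc_matrices n \<inter> bounded_matrices n M"
    and B: "B \<in> pc_matrices n \<inter> bounded_matrices n M"
    and CI: "CI n B \<le> \<alpha>" and M: "M \<ge> 1"
  obtains x y where "feasible n M A \<alpha> x y" "objective n y = real (pc_dist n A B)"
proof
  define x where "x = (\<lambda>i j. ln (B $$ (i,j)))"
  define y where "y = (\<lambda>i j. if A $$ (i,j) = B $$ (i,j) then 0 else 1 :: real)"
  have ln_bounds: "- ln M \<le> ln (C $$ (i,j)) \<and> ln (C $$ (i,j)) \<le> ln M"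
    if C: "C \<in> pc_matrices n \<inter> bounded_matrices n M" and "i < n" "j < n" for C i j
  proof -
    have "0 < C $$ (i,j)" "1 / M \<le> C $$ (i,j)" "C $$ (i,j) \<le> M"
      using pc_matricesD(2)[of C n i j] that by (auto simp: bounded_matrices_def)
    moreover from this have "ln (1 / M) \<le> ln (C $$ (i,j))"
      using M by (subst ln_le_cancel_iff) auto
    ultimately show ?thesis
      using M by (simp add: ln_div)
  qed
  have B_exp: "B $$ (i,j) = exp (x i j)" if "i < n" "j < n" for i j
    using pc_matricesD(2)[of B n i j] B that by (simp add: x_def)
  have anti: "x i j = - x j i" if "i < n" "j < n" for i j
  proof -
    have pos: "B $$ (j,i) > 0"
      using pc_matricesD(2)[of B n j i] B that by blast
    have "x i j = ln (1 / B $$ (j,i))"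
      unfolding x_def by (subst pc_matricesD(3)[of B n i j]) (use B that in simp_all)
    then show ?thesis using pos by (simp add: x_def ln_div)
  qed
  show "feasible n M A \<alpha> x y"
    unfolding feasible_def
  proof (intro conjI allI impI)
    show "(\<Sum>i\<in>{0..<n-2}. \<Sum>j\<in>{i+1..<n-1}. \<Sum>k\<in>{j+1..<n}.
        exp (x i k - x i j - x j k) + exp (x i j + x j k - x i k)) \<le> alpha_star n \<alpha>"
      using CI CI_le_iff_exp_sum_le[of B n x \<alpha>] B n B_exp by auto
  next
    fix i j assume ij: "i < j \<and> j < n"
    then have "i < n" "j < n" by auto
    \<comment> \<open>Two numbers in \<open>[-ln M, ln M]\<close> differ by at most \<open>2 ln M\<close>.\<close>
    note bA = ln_bounds[OF A this] and bB = ln_bounds[OF B this]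
    show "x i j = - x j i" using ij by (intro anti) auto
    show "- ln M \<le> x i j" "x i j \<le> ln M" using bB by (auto simp: x_def)
    show "- 2 * ln M * y i j \<le> x i j - ln (A $$ (i, j))"
      "x i j - ln (A $$ (i, j)) \<le> 2 * ln M * y i j"
      using bA bB by (auto simp: x_def y_def)
    show "y i j \<in> {0, 1}" by (simp add: y_def)
  qed
  show "objective n y = real (pc_dist n A B)"
    by (subst objective_eq_card_support) (auto simp: y_def pc_dist_def intro!: arg_cong[of _ _ card])
qed

lemma feasible_yields_pc_matrix:
  assumes n: "n \<ge> 3" and M: "M \<ge> 1"
    and A: "A \<in> pc_matrices n"
    and feas: "feasible n M A \<alpha> x y"
  obtains B where "B \<in> pc_matrices n \<inter> bounded_matrices n M" "CI n B \<le> \<alpha>"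
    "real (pc_dist n A B) \<le> objective n y"
proof
  \<comment> \<open>The diagonal is set separately because the diagonal values of \<open>x\<close> are arbitrary.\<close>
  define B where "B = mat n n (\<lambda>(i,j). if i = j then 1 else exp (x i j))"
  have sum_le: "(\<Sum>i\<in>{0..<n-2}. \<Sum>j\<in>{i+1..<n-1}. \<Sum>k\<in>{j+1..<n}.
      exp (x i k - x i j - x j k) + exp (x i j + x j k - x i k)) \<le> alpha_star n \<alpha>"
    using feas unfolding feasible_def by blast
  have upper: "x i j = - x j i" "- ln M \<le> x i j" "x i j \<le> ln M"
    "- 2 * ln M * y i j \<le> x i j - ln (A $$ (i, j))"
    "x i j - ln (A $$ (i, j)) \<le> 2 * ln M * y i j"
    "y i j \<in> {0, 1}" if "i < j" "j < n" for i j
    using feas that unfolding feasible_def by blast+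
  have x_anti: "x j i = - x i j" if "i \<noteq> j" "i < n" "j < n" for i j
    using upper(1)[of i j] upper(1)[of j i] that by (cases "i < j") auto
  have x_bounds: "- ln M \<le> x i j \<and> x i j \<le> ln M" if "i \<noteq> j" "i < n" "j < n" for i j
  proof (cases "i < j")
    case False
    then have "- ln M \<le> x j i \<and> x j i \<le> ln M" using upper(2,3)[of j i] that by auto
    then show ?thesis using x_anti[OF that] by auto
  qed (use upper(2,3) that in auto)
  have exp_bounds: "1 / M \<le> exp u \<and> exp u \<le> M" if "- ln M \<le> u \<and> u \<le> ln M" for u
  proof -
    have "exp (- ln M) \<le> exp u" "exp u \<le> exp (ln M)" using that by auto
    then show ?thesis using M by (simp add: exp_minus divide_inverse)
  qed
  have B_pc: "B \<in> pc_matrices n"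
  proof -
    have "B $$ (i,j) = 1 / B $$ (j,i)" if "i < n" "j < n" for i j
      using x_anti[of j i] that by (cases "i = j") (simp_all add: B_def exp_minus divide_inverse)
    moreover have "B $$ (i,j) > 0" if "i < n" "j < n" for i j
      using that by (simp add: B_def)
    moreover have "B \<in> carrier_mat n n"
      by (simp add: B_def)
    ultimately show ?thesis
      unfolding pc_matrices_def by blast
  qed
  moreover have "B \<in> bounded_matrices n M"
    unfolding bounded_matrices_def using exp_bounds[OF x_bounds] M by (auto simp: B_def)
  ultimately show "B \<in> pc_matrices n \<inter> bounded_matrices n M" by simp
  have "B $$ (i,j) = exp (x i j)" if "i < j" "j < n" for i j
    using that by (simp add: B_def)
  then show "CI n B \<le> \<alpha>"
    using CI_le_iff_exp_sum_le[OF B_pc n] sum_le by blast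
  have "{(i, j). i < j \<and> j < n \<and> A $$ (i, j) \<noteq> B $$ (i, j)}
      \<subseteq> {(i, j). i < j \<and> j < n \<and> y i j \<noteq> 0}"
  proof clarify
    fix i j assume ij: "i < j" "j < n" "A $$ (i, j) \<noteq> B $$ (i, j)" "y i j = 0"
    then have "x i j = ln (A $$ (i,j))" using upper(4,5)[of i j] by simp
    moreover have "A $$ (i,j) > 0" using pc_matricesD(2)[OF A] ij by simp
    ultimately show False using ij by (simp add: B_def)
  qed
  moreover have "finite {(i, j). i < j \<and> j < n \<and> y i j \<noteq> 0}"
    by (rule finite_subset[of _ "{..<n} \<times> {..<n}"]) auto
  ultimately show "real (pc_dist n A B) \<le> objective n y"
    using upper(6) by (subst objective_eq_card_support) (simp_all add: pc_dist_def card_mono)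
qed

text \<open>Every triad of the matrix of ones is consistent and has determinant 0, so both problems
  have an admissible point for every nonnegative threshold.\<close>

lemma ones_matrix_acceptable:
  assumes n: "n \<ge> 3" and M: "M \<ge> 1" and \<alpha>: "\<alpha> \<ge> 0"
  defines "J \<equiv> mat n n (\<lambda>_. 1 :: real)"
  shows "J \<in> pc_matrices n \<inter> bounded_matrices n M" "CI n J \<le> \<alpha>"
proof -
  show J: "J \<in> pc_matrices n \<inter> bounded_matrices n M"
    using M by (auto simp: J_def pc_matrices_def bounded_matrices_def)
  have "(\<Sum>t\<in>triad_indices n. det (triad J t)) = 0"
  proof (rule sum.neutral, rule ballI)
    fix t assume "t \<in> triad_indices n"
    then obtain i j k where t: "t = (i,j,k)" "i < j" "j < k" "k < n"
      by (auto simp: triad_indices_def)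
    have "det (triad J (i,j,k)) = 1 / (1 * 1) + 1 * 1 / 1 - 2"
      using J t(2-) by (subst det_triad[of _ n]) (auto simp: J_def)
    then show "det (triad J t) = 0" by (simp add: t)
  qed
  then show "CI n J \<le> \<alpha>"
    using J n \<alpha> by (simp add: CI_eq_mean_det_triad)
qed

section \<open>Equality of the two minima\<close>

theorem theorem8:
  fixes n :: nat and M \<alpha> :: real and A :: "real mat"
  assumes "n \<ge> 3"
    and "M \<ge> 1"
    and "A \<in> pc_matrices n \<inter> bounded_matrices n M"
    and "\<alpha> \<ge> 0"
  shows "\<exists>v::nat.
    is_min_value (\<lambda>(x, y). objective n y) {(x, y). feasible n M A \<alpha> x y} (real v) \<and>
    is_min_value (\<lambda>B. pc_dist n A B)
      {B \<in> pc_matrices n \<inter> bounded_matrices n M. CI n B \<le> \<alpha>} v"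
proof -
  let ?S = "{B \<in> pc_matrices n \<inter> bounded_matrices n M. CI n B \<le> \<alpha>}"
  have "mat n n (\<lambda>_. 1) \<in> ?S"
    using ones_matrix_acceptable[OF assms(1,2,4)] by simp
  then obtain B where B: "B \<in> ?S" and least: "\<And>C. C \<in> ?S \<Longrightarrow> pc_dist n A B \<le> pc_dist n A C"
    using ex_has_least_nat[of "\<lambda>C. C \<in> ?S" _ "pc_dist n A"] by blast
  obtain x y where xy: "feasible n M A \<alpha> x y" "objective n y = real (pc_dist n A B)"
    using B by (auto intro: pc_matrix_yields_feasible[OF assms(1,3) _ _ assms(2)])
  have "real (pc_dist n A B) \<le> objective n y'" if feas: "feasible n M A \<alpha> x' y'" for x' y'
  proof -
    obtain C where "C \<in> ?S" "real (pc_dist n A C) \<le> objective n y'"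
      using feasible_yields_pc_matrix[OF assms(1,2) _ feas] assms(3) by blast
    then show ?thesis using least[of C] by linarith
  qed
  then have "is_min_value (\<lambda>(x, y). objective n y) {(x, y). feasible n M A \<alpha> x y}
      (real (pc_dist n A B))"
    using xy by (force simp: is_min_value_def)
  moreover have "is_min_value (\<lambda>B. pc_dist n A B) ?S (pc_dist n A B)"
    using B least by (auto simp: is_min_value_def)
  ultimately show ?thesis by blast
qed

end
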